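(* Let $a,b,m\in\mathbb{Z}$ with $a\ge 2$, $m>1$, $\gcd(b,m)=1$, and $b\ge -(a-2)m-2$, and let $S=S_{a,b}(m)$ and $d=(a-1)m+b$. Let $n$ be the smallest positive integer such that $A_n\ge m$, and let $A=\{A_1,\ldots,A_{n-1}\}$. If the maximum of $\{\,d\ell+\mathsf{m}_A(\ell)m \mid 0\le \ell\le m-1\,\}$ is attained at $\ell=m-1$, then \[ \operatorname{F}(S)=d(m-1)+\mathsf{m}_A(m-1)m-m. \]
   Context: $\mathbb{N}=\{0,1,2,\dots\}$. Let $T_{a,b}(z)=az+b$, with $T_{a,b}^i$ its $i$-fold composition ($T_{a,b}^0$ the identity), and let $S_{a,b}(m)=\langle T_{a,b}^i(m)\mid i\ge 0\rangle$ be the submonoid of $(\mathbb{N},+)$ generated by the orbit of $m$; under the stated hypotheses it is a numerical semigroup (finite complement in $\mathbb{N}$) whose smallest positive element is $m$. The Frobenius number $\operatorname{F}(S)$ is the largest integer not belonging to $S$. Set $A_i=(a^i-1)/(a-1)$ for $i\ge 0$ (so $A_1=1$); since $m>1$, $n\ge 2$. The index $\ell$ ranges over integers. $\mathsf{m}_A(\ell)$ is the minimum factorization length of $\ell$ with respect to $A$, i.e. the minimum of $\sum_{i=1}^{n-1}u_i$ over all $(u_1,\ldots,u_{n-1})\in\mathbb{N}^{n-1}$ with $\ell=\sum_{i=1}^{n-1}u_iA_i$. *)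

theory Defs
  imports Main
begin

inductive_set generated_submonoid :: "'a::comm_monoid_add set \<Rightarrow> 'a set"
  for G :: "'a set" where
  zero: "0 \<in> generated_submonoid G"
| base: "x \<in> G \<Longrightarrow> x \<in> generated_submonoid G"
| add: "x \<in> generated_submonoid G \<Longrightarrow> y \<in> generated_submonoid G
    \<Longrightarrow> x + y \<in> generated_submonoid G"

definition affine_map :: "int \<Rightarrow> int \<Rightarrow> int \<Rightarrow> int" where
  "affine_map a b z = a * z + b"

text \<open>The semigroup is kept as a set of integers, since the Frobenius number is an integer and
  \<open>b\<close> may be negative. Under the standing hypotheses the orbit of \<open>m\<close> consists of natural numbers,
  so this is the submonoid of the natural numbers generated by the orbit; see
  \<open>orbit_semigroup_subset_Nats\<close>.\<close>

definition orbit_semigroup :: "int \<Rightarrow> int \<Rightarrow> int \<Rightarrow> int set" where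
  "orbit_semigroup a b m = generated_submonoid {(affine_map a b ^^ i) m | i. True}"

text \<open>The largest integer (not merely natural number) outside \<open>S\<close>; in particular it is \<open>-1\<close> when
  \<open>S\<close> is the set of all natural numbers. It is only meaningful if the integers outside \<open>S\<close> have a
  largest element, as for numerical semigroups.\<close>

definition frobenius_number :: "int set \<Rightarrow> int" where
  "frobenius_number S = (GREATEST x. x \<notin> S)"

text \<open>The division is exact.\<close>

definition repunit :: "int \<Rightarrow> nat \<Rightarrow> int" where
  "repunit a i = (a ^ i - 1) div (a - 1)"

text \<open>The generators are given as a family \<open>A\<close> over a finite index set \<open>I\<close>, and \<open>u i\<close> is the
  multiplicity of \<open>A i\<close>. It is only meaningful for \<open>l\<close> that admit a factorization.\<close>

definition min_fact_length :: "(nat \<Rightarrow> int) \<Rightarrow> nat set \<Rightarrow> int \<Rightarrow> nat" where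
  "min_fact_length A I l =
    (LEAST k. \<exists>u :: nat \<Rightarrow> nat. l = (\<Sum>i\<in>I. int (u i) * A i) \<and> k = (\<Sum>i\<in>I. u i))"

lemma orbit_semigroup_subset_Nats:
  assumes "a \<ge> 2" "m > 1" "b \<ge> - (a - 2) * m - 2"
  shows "orbit_semigroup a b m \<subseteq> \<nat>"
proof
  have orbit: "(affine_map a b ^^ i) m \<ge> m" for i
  proof (induction i)
    case (Suc i)
    let ?x = "(affine_map a b ^^ i) m"
    have "a * ?x \<ge> a * m"
      using Suc assms(1) by (intro mult_left_mono) auto
    moreover have "a * m + b \<ge> 2 * m - 2"
      using assms(3) by (simp add: algebra_simps)
    moreover have "(affine_map a b ^^ Suc i) m = a * ?x + b"
      by (simp add: affine_map_def[of a b ?x])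
    ultimately show ?case
      using assms(2) by linarith
  qed simp
  fix x assume "x \<in> orbit_semigroup a b m"
  then have "x \<ge> 0"
    unfolding orbit_semigroup_def
  proof (induction rule: generated_submonoid.induct)
    case (base x)
    then obtain i where "x = (affine_map a b ^^ i) m" by blast
    with orbit[of i] assms(2) show ?case by linarith
  qed auto
  then show "x \<in> \<nat>"
    by (simp add: Nats_altdef1)
qed

end

theory Submission
  imports Defs
begin

text \<open>The orbit of \<open>m\<close> is \<open>T\<^sup>i(m) = m + d A\<^sub>i\<close>, where \<open>d \<ge> m - 2\<close> is coprime to \<open>m\<close>.
  The semigroup consists of the integers \<open>d l + k m\<close> with \<open>0 \<le> l < m\<close> and \<open>k \<ge> m\<^sub>A(l)\<close>: if a sum
  or a generator involves a coefficient \<open>l' = l + q m\<close> of \<open>d\<close> with \<open>q \<ge> 1\<close>, then trading \<open>q m\<close> copies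
  of \<open>d\<close> for \<open>q d\<close> copies of \<open>m\<close> leaves enough copies of \<open>m\<close>, because \<open>m\<^sub>A(l) \<le> l\<close> and
  \<open>d \<ge> m - 2\<close>. So the numbers \<open>d l + m\<^sub>A(l) m\<close> form the Apery set of \<open>m\<close>, and the Frobenius number
  is its maximum minus \<open>m\<close>.\<close>

section \<open>Multiples and finite sums in a generated submonoid\<close>

lemma generated_submonoid_multiple:
  fixes x :: "'a::comm_semiring_1"
  assumes "x \<in> generated_submonoid G"
  shows "of_nat k * x \<in> generated_submonoid G"
proof (induction k)
  case (Suc k)
  then show ?case
    using generated_submonoid.add[OF assms] by (simp add: distrib_right)
qed (simp add: generated_submonoid.zero)

lemma generated_submonoid_sum:
  assumes "\<And>i. i \<in> I \<Longrightarrow> f i \<in> generated_submonoid G"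
  shows "(\<Sum>i\<in>I. f i) \<in> generated_submonoid G"
  using assms
  by (induction I rule: infinite_finite_induct)
    (auto intro: generated_submonoid.zero generated_submonoid.add)

section \<open>The numbers \<open>repunit a i\<close> and the orbit of \<open>m\<close>\<close>

lemma repunit_eq_sum:
  assumes "a \<ge> 2"
  shows "repunit a i = (\<Sum>j<i. a ^ j)"
  using assms by (simp add: repunit_def power_diff_1_eq)

lemma repunit_mono:
  assumes "a \<ge> 2" "i \<le> j"
  shows "repunit a i \<le> repunit a j"
  using assms by (auto simp: repunit_eq_sum intro!: sum_mono2)

lemma repunit_ge_index:
  assumes "a \<ge> 2"
  shows "int i \<le> repunit a i"
proof -
  have "(\<Sum>j<i. 1) \<le> (\<Sum>j<i. a ^ j)"
    using assms by (intro sum_mono) simp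
  then show ?thesis
    using assms by (simp add: repunit_eq_sum)
qed

text \<open>The first increment of the orbit is \<open>d\<close>, each later one is \<open>a\<close>
  times its predecessor, and \<open>repunit a i\<close> adds up this geometric progression.\<close>

lemma affine_map_funpow:
  assumes "a \<ge> 2"
  shows "(affine_map a b ^^ i) m = m + ((a - 1) * m + b) * repunit a i"
proof (induction i)
  case 0
  then show ?case by (simp add: repunit_def)
next
  case (Suc i)
  have "repunit a (Suc i) = 1 + a * repunit a i"
    by (simp add: repunit_eq_sum[OF assms] sum.lessThan_Suc_shift sum_distrib_left del: sum.lessThan_Suc)
  then have "m + ((a - 1) * m + b) * repunit a (Suc i)
      = a * (m + ((a - 1) * m + b) * repunit a i) + b"
    by (simp add: algebra_simps)
  moreover have "(affine_map a b ^^ Suc i) m = a * (affine_map a b ^^ i) m + b"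
    by (simp add: affine_map_def[of a b "(affine_map a b ^^ i) m"])
  ultimately show ?case
    by (simp only: Suc)
qed

section \<open>Minimum factorization lengths\<close>

lemma min_fact_length_le:
  assumes "l = (\<Sum>i\<in>I. int (u i) * A i)"
  shows "min_fact_length A I l \<le> (\<Sum>i\<in>I. u i)"
  unfolding min_fact_length_def using assms by (intro Least_le) blast

lemma min_fact_length_attained:
  assumes "l = (\<Sum>i\<in>I. int (v i) * A i)"
  obtains u where "l = (\<Sum>i\<in>I. int (u i) * A i)" "min_fact_length A I l = (\<Sum>i\<in>I. u i)"
proof -
  have "\<exists>k. \<exists>u :: nat \<Rightarrow> nat. l = (\<Sum>i\<in>I. int (u i) * A i) \<and> k = (\<Sum>i\<in>I. u i)"
    using assms by blast
  from LeastI_ex[OF this] show ?thesis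
    unfolding min_fact_length_def[symmetric] using that by blast
qed

lemma factorization_single:
  assumes "finite I" "j \<in> I"
  shows "(\<Sum>i\<in>I. int (if i = j then k else 0) * A i) = int k * A j"
    and "(\<Sum>i\<in>I. if i = j then k else 0) = k"
proof -
  have "(\<Sum>i\<in>I. int (if i = j then k else 0) * A i) = (\<Sum>i\<in>I. if i = j then int k * A i else 0)"
    by (intro sum.cong) auto
  then show "(\<Sum>i\<in>I. int (if i = j then k else 0) * A i) = int k * A j"
    using assms by simp
qed (use assms in simp)

lemma min_fact_length_multiple_le:
  assumes "finite I" "j \<in> I"
  shows "min_fact_length A I (int k * A j) \<le> k"
  using min_fact_length_le[where u = "\<lambda>i. if i = j then k else 0" and A = A and I = I]
    factorization_single[OF assms] by metis

text \<open>Since \<open>A j = 1\<close>, taking \<open>l\<close> copies of it is a factorization,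
  so the \<open>LEAST\<close> ranges over a nonempty set.\<close>

lemma min_fact_length_attained_unit:
  assumes "finite I" "j \<in> I" "A j = 1" "l \<ge> 0"
  obtains u where "l = (\<Sum>i\<in>I. int (u i) * A i)" "min_fact_length A I l = (\<Sum>i\<in>I. u i)"
proof (rule min_fact_length_attained)
  show "l = (\<Sum>i\<in>I. int (if i = j then nat l else 0) * A i)"
    using factorization_single(1)[OF assms(1,2)] assms(3,4) by simp
qed (rule that)

lemma min_fact_length_le_self:
  assumes "finite I" "j \<in> I" "A j = 1" "l \<ge> 0"
  shows "int (min_fact_length A I l) \<le> l"
  using min_fact_length_multiple_le[OF assms(1,2), of A "nat l"] assms(3,4) by simp

text \<open>Adding shortest factorizations of \<open>l\<close> and \<open>l'\<close> termwise
  factors \<open>l + l'\<close>, though perhaps not in the shortest way.\<close>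

lemma min_fact_length_add_le:
  assumes "finite I" "j \<in> I" "A j = 1" "l \<ge> 0" "l' \<ge> 0"
  shows "min_fact_length A I (l + l') \<le> min_fact_length A I l + min_fact_length A I l'"
proof -
  obtain u where u: "l = (\<Sum>i\<in>I. int (u i) * A i)" "min_fact_length A I l = (\<Sum>i\<in>I. u i)"
    using min_fact_length_attained_unit[of I j A l] assms by blast
  obtain v where v: "l' = (\<Sum>i\<in>I. int (v i) * A i)" "min_fact_length A I l' = (\<Sum>i\<in>I. v i)"
    using min_fact_length_attained_unit[of I j A l'] assms by blast
  have "l + l' = (\<Sum>i\<in>I. int (u i + v i) * A i)"
    by (subst u(1), subst v(1)) (simp add: sum.distrib distrib_right)
  from min_fact_length_le[OF this] show ?thesis
    by (simp add: sum.distrib u(2) v(2))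
qed

section \<open>The semigroup described through the Apery set of \<open>m\<close>\<close>

lemma orbit_semigroup_iff:
  fixes a b m d x :: int and n :: nat
  defines "mA \<equiv> min_fact_length (repunit a) {1..n-1}"
  assumes a: "a \<ge> 2" and m: "m > 1"
    and d: "d = (a - 1) * m + b" and dm: "d \<ge> m - 2" and dpos: "d > 0"
    and n: "n = (LEAST k. k > 0 \<and> repunit a k \<ge> m)"
  shows "x \<in> orbit_semigroup a b m \<longleftrightarrow>
    (\<exists>l k. 0 \<le> l \<and> l < m \<and> int (mA l) \<le> k \<and> x = d * l + k * m)"
proof -
  define I where "I = {1..n-1}"
  have fin: "finite I" by (simp add: I_def)
  \<comment> \<open>A witness that makes the \<open>LEAST\<close> defining \<open>n\<close>
    meaningful.\<close>
  have "nat m > 0 \<and> repunit a (nat m) \<ge> m"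
    using repunit_ge_index[OF a, of "nat m"] m by simp
  then have nprop: "n > 0" "repunit a n \<ge> m"
    unfolding n using LeastI[of "\<lambda>k. k > 0 \<and> repunit a k \<ge> m"] by blast+
  have rep0: "repunit a 0 = 0" and rep1: "repunit a 1 = 1"
    using a by (simp_all add: repunit_def)
  \<comment> \<open>As \<open>repunit a 1 = 1 < m\<close>, the index set contains 1, so every
    nonnegative integer has a factorization.\<close>
  have "n \<noteq> 1"
    using nprop(2) rep1 m by auto
  with nprop(1) have one: "1 \<in> I"
    by (simp add: I_def)
  have mA: "mA = min_fact_length (repunit a) I"
    by (simp add: mA_def I_def)
  note self_le = min_fact_length_le_self[of I 1 "repunit a", OF fin one rep1, folded mA]
  note add_le = min_fact_length_add_le[of I 1 "repunit a", OF fin one rep1, folded mA]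
  have orbit: "(affine_map a b ^^ i) m = m + d * repunit a i" for i
    using affine_map_funpow[OF a] d by simp

  let ?P = "\<lambda>x. \<exists>l k. 0 \<le> l \<and> l < m \<and> int (mA l) \<le> k \<and> x = d * l + k * m"
  have "?P x" if "x \<in> orbit_semigroup a b m"
    using that unfolding orbit_semigroup_def
  proof (induction rule: generated_submonoid.induct)
    case zero
    show ?case
      using self_le[of 0] m by (intro exI[of _ 0]) auto
  next
    case (base x)
    then obtain i where x: "x = m + d * repunit a i"
      using orbit by auto
    have nonneg: "repunit a i \<ge> 0"
      using repunit_ge_index[OF a, of i] by simp
    show ?case
    proof (cases "repunit a i < m")
      case True
      \<comment> \<open>Below \<open>m\<close>, the value is 0 or one of the elements of
        \<open>A\<close>, so the single copy of \<open>m\<close> in \<open>x\<close>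
        suffices.\<close>
      have "mA (repunit a i) \<le> 1"
      proof (cases "i = 0")
        case True
        then show ?thesis
          using self_le[of 0] rep0 by simp
      next
        case False
        have "i < n"
          using True nprop(2) repunit_mono[OF a, of n i] by force
        with False have "i \<in> I"
          by (simp add: I_def)
        then show ?thesis
          using min_fact_length_multiple_le[OF fin, of i "repunit a" 1] mA by simp
      qed
      then show ?thesis
        using True nonneg x by (intro exI[of _ "repunit a i"] exI[of _ 1]) auto
    next
      case False
      define l q where "l = repunit a i mod m" and "q = repunit a i div m"
      have split: "repunit a i = l + q * m"
        by (simp add: l_def q_def)
      have l: "0 \<le> l" "l < m"
        using m by (simp_all add: l_def)
      have "q \<ge> 1"
        using False m by (simp add: q_def pos_imp_zdiv_pos_iff int_one_le_iff_zero_less)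
      then have "1 * d \<le> q * d"
        using dpos by (intro mult_right_mono) auto
      \<comment> \<open>Here \<open>1 + q * d \<ge> 1 + d \<ge> m - 1 \<ge> l\<close>.\<close>
      then have "int (mA l) \<le> 1 + q * d"
        using self_le[OF l(1)] l(2) dm by linarith
      then show ?thesis
        using l x split
        by (intro exI[of _ l] exI[of _ "1 + q * d"]) (simp add: algebra_simps)
    qed
  next
    case (add x y)
    then obtain l k l' k' where *: "0 \<le> l" "l < m" "int (mA l) \<le> k" "x = d * l + k * m"
      "0 \<le> l'" "l' < m" "int (mA l') \<le> k'" "y = d * l' + k' * m"
      by blast
    show ?case
    proof (cases "l + l' < m")
      case True
      have "int (mA (l + l')) \<le> k + k'"
        using add_le[of l l'] * by linarith
      with True * show ?thesis
        by (intro exI[of _ "l + l'"] exI[of _ "k + k'"]) (simp add: algebra_simps)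
    next
      case False
      \<comment> \<open>Both \<open>l\<close> and \<open>l'\<close> are at most
        \<open>m - 1\<close>, so \<open>l + l' - m \<le> m - 2 \<le> d\<close>; also
        \<open>k\<close> and \<open>k'\<close> are nonnegative.\<close>
      have "int (mA (l + l' - m)) \<le> k + k' + d"
        using self_le[of "l + l' - m"] False * dm by linarith
      with False * show ?thesis
        by (intro exI[of _ "l + l' - m"] exI[of _ "k + k' + d"]) (simp add: algebra_simps)
    qed
  qed
  moreover have "x \<in> orbit_semigroup a b m" if "?P x"
  proof -
    from that obtain l k where *: "0 \<le> l" "int (mA l) \<le> k" "x = d * l + k * m"
      by blast
    obtain u where u: "l = (\<Sum>i\<in>I. int (u i) * repunit a i)" "mA l = (\<Sum>i\<in>I. u i)"
      by (rule min_fact_length_attained_unit[of I 1 "repunit a" l, OF fin one rep1 *(1), folded mA])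
    have gen: "m + d * repunit a i \<in> orbit_semigroup a b m" for i
      unfolding orbit_semigroup_def orbit[symmetric] by (intro generated_submonoid.base) blast
    \<comment> \<open>A shortest factorization of \<open>l\<close> yields exactly
      \<open>mA l\<close> copies of \<open>m\<close>; the missing \<open>k - mA l\<close> copies
      come from the generator with \<open>i = 0\<close>, which is \<open>m\<close> itself.\<close>
    have "(\<Sum>i\<in>I. int (u i) * (m + d * repunit a i)) \<in> orbit_semigroup a b m"
      using gen unfolding orbit_semigroup_def
      by (intro generated_submonoid_sum generated_submonoid_multiple[where 'a = int])
    also have "(\<Sum>i\<in>I. int (u i) * (m + d * repunit a i)) = d * l + int (mA l) * m"
    proof -
      have "(\<Sum>i\<in>I. int (u i) * (m + d * repunit a i)) =
          d * (\<Sum>i\<in>I. int (u i) * repunit a i) + int (\<Sum>i\<in>I. u i) * m"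
        by (simp add: sum_distrib_left sum_distrib_right sum.distrib algebra_simps)
      then show ?thesis
        using u by simp
    qed
    finally have "d * l + int (mA l) * m \<in> orbit_semigroup a b m" .
    moreover have "int (nat (k - int (mA l))) * m \<in> orbit_semigroup a b m"
      using gen[of 0] rep0 unfolding orbit_semigroup_def
      by (intro generated_submonoid_multiple[where 'a = int]) simp
    ultimately have "d * l + int (mA l) * m + int (nat (k - int (mA l))) * m \<in> orbit_semigroup a b m"
      unfolding orbit_semigroup_def by (rule generated_submonoid.add)
    then show ?thesis
      using * by (simp add: algebra_simps)
  qed
  ultimately show ?thesis by blast
qed

section \<open>The Frobenius number from the largest Apery element\<close>

theorem corollary4p9:
  fixes a b m d :: int and n :: nat and S :: "int set" and mA :: "int \<Rightarrow> nat"
  assumes "a \<ge> 2" and "m > 1" and "gcd b m = 1" and "b \<ge> - (a - 2) * m - 2"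
    and "S = orbit_semigroup a b m"
    and "d = (a - 1) * m + b"
    and "n = (LEAST k. k > 0 \<and> repunit a k \<ge> m)"
    and "mA = min_fact_length (repunit a) {1..n-1}"
    and "Max {d * l + int (mA l) * m | l. 0 \<le> l \<and> l \<le> m - 1} = d * (m - 1) + int (mA (m - 1)) * m"
  shows "frobenius_number S = d * (m - 1) + int (mA (m - 1)) * m - m"
proof -
  have coprime: "gcd d m = 1"
    using assms(3) gcd_add_mult[of m "a - 1" b] by (simp add: assms(6) gcd.commute)
  have dm: "d \<ge> m - 2"
    using assms(4) by (simp add: assms(6) algebra_simps)
  \<comment> \<open>For \<open>m = 2\<close> the bound \<open>dm\<close> still allows 0, but then
    the gcd would be \<open>m > 1\<close>.\<close>
  have "d \<noteq> 0"
    using coprime assms(2) by auto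
  with dm assms(2) have dpos: "d > 0"
    by linarith
  have iff: "x \<in> S \<longleftrightarrow> (\<exists>l k. 0 \<le> l \<and> l < m \<and> int (mA l) \<le> k \<and> x = d * l + k * m)" for x
    using orbit_semigroup_iff[OF assms(1,2,6) dm dpos assms(7)] assms(5,8) by simp
  have "{d * l + int (mA l) * m | l. 0 \<le> l \<and> l \<le> m - 1} = (\<lambda>l. d * l + int (mA l) * m) ` {0..m-1}"
    by auto
  then have "finite {d * l + int (mA l) * m | l. 0 \<le> l \<and> l \<le> m - 1}"
    by simp
  from Max_ge[OF this] have max: "d * l + int (mA l) * m \<le> d * (m - 1) + int (mA (m - 1)) * m"
    if "0 \<le> l" "l < m" for l
    unfolding assms(9) using that by force
  show ?thesis
    unfolding frobenius_number_def
  proof (rule Greatest_equality)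
    show "d * (m - 1) + int (mA (m - 1)) * m - m \<notin> S"
    proof
      assume "d * (m - 1) + int (mA (m - 1)) * m - m \<in> S"
      then obtain l k where l: "0 \<le> l" "l < m" and k: "int (mA l) \<le> k"
        and eq: "d * (m - 1) + int (mA (m - 1)) * m - m = d * l + k * m"
        using iff by blast
      \<comment> \<open>Coprimality of \<open>d\<close> and \<open>m\<close> forces
        \<open>l = m - 1\<close>; then \<open>k\<close> is \<open>mA (m - 1) - 1\<close>, one too
        small.\<close>
      from eq have diff: "d * (m - 1 - l) = m * (k + 1 - int (mA (m - 1)))"
        by (simp add: algebra_simps)
      then have "m dvd d * (m - 1 - l)"
        by simp
      then have "m dvd m - 1 - l"
        using coprime coprime_dvd_mult_right_iff[of m d]
        by (simp add: coprime_iff_gcd_eq_1 gcd.commute)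
      with l have "m - 1 - l = 0"
        using zdvd_not_zless[of "m - 1 - l" m] by linarith
      then have "l = m - 1"
        by simp
      with diff k assms(2) show False
        by simp
    qed
  next
    fix y assume y: "y \<notin> S"
    obtain u v where uv: "u * d + v * m = 1"
      using bezout_int[of d m] coprime by auto
    \<comment> \<open>Modulo \<open>m\<close>, \<open>u\<close> inverts \<open>d\<close>, so this is
      the residue with \<open>d * l\<close> congruent to \<open>y\<close>.\<close>
    define l where "l = (u * y) mod m"
    have l: "0 \<le> l" "l < m"
      using assms(2) by (simp_all add: l_def)
    have "y = (u * d + v * m) * y"
      using uv by simp
    also have "\<dots> = d * (u * y) + v * y * m"
      by (simp add: algebra_simps)
    also have "u * y = l + m * ((u * y) div m)"
      by (simp add: l_def)
    finally have "y = d * l + (d * ((u * y) div m) + v * y) * m"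
      by (simp only: algebra_simps)
    then obtain t where t: "y = d * l + t * m" ..
    \<comment> \<open>Otherwise \<open>l\<close> and \<open>t\<close> would witness
      \<open>y \<in> S\<close>. Hence \<open>y\<close> is at most the Apery element of its class
      minus \<open>m\<close>, and \<open>max\<close> bounds that element.\<close>
    with y l iff have "t \<le> int (mA l) - 1"
      by force
    then have "t * m \<le> (int (mA l) - 1) * m"
      using assms(2) by (intro mult_right_mono) auto
    with t max[OF l] show "y \<le> d * (m - 1) + int (mA (m - 1)) * m - m"
      by (simp add: left_diff_distrib)
  qed
qed

end
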